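(* Let $2k+1 = (2r+1)(2s+1)$ for $r,s\ge 1$. If $G\in \mathcal G_2(2r+1,2s+1)$, then $\chi_{la}(G) = 3$.
   Context: For a graph $G$, a bijection $f:E(G)\to[1,|E(G)|]$ is a local antimagic labeling if $f^+(u)\ne f^+(v)$ for every edge $uv$, where $f^+(u)$ is the sum of the labels of edges incident to $u$; $\chi_{la}(G)$ is the minimum number of distinct induced vertex labels over all local antimagic labelings. Let $k\ge 1$ and consider $(2k+1)(P_2\vee O_2)$ with vertices $u_i,v_i,x_{i,1},x_{i,2}$ and edges $u_iv_i$, $u_ix_{i,j}$, $v_ix_{i,j}$ ($1\le i\le 2k+1$, $j=1,2$). Label the edges bijectively with $[1,5(2k+1)]$ as follows: for $1\le i\le k+1$: $f(u_ix_{i,1})=10k+7-2i$, $f(u_ix_{i,2})=5k+2+i$, $f(u_iv_i)=i$, $f(v_ix_{i,1})=3k+1+i$, $f(v_ix_{i,2})=8k+6-2i$; for $k+2\le i\le 2k+1$: $f(u_ix_{i,1})=12k+8-2i$, $f(u_ix_{i,2})=3k+1+i$, $f(u_iv_i)=i$, $f(v_ix_{i,1})=k+i$, $f(v_ix_{i,2})=10k+7-2i$. Then $f^+(u_i)=15k+9$, $f^+(v_i)=11k+7$ and $f^+(x_{i,j})=13k+8-i$. For $j=1,2$, let $S_j=\{f^+(x_{i,j})\mid 1\le i\le 2k+1\}$, an arithmetic sequence with common difference $-1$ and total sum $(2k+1)(12k+7)$. Using a $(2r+1)\times(2s+1)$ magic rectangle, each $S_j$ can be partitioned into $2r+1$ blocks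 of size $2s+1$, each block having sum $(2s+1)(12k+7)$ (such a partition need not be unique). $\mathcal G_2(2r+1,2s+1)$ is the set of all graphs obtained by choosing such partitions of $S_1$ and $S_2$ and, for each block, merging the $2s+1$ degree-2 vertices whose induced labels lie in that block into a single new vertex of degree $4s+2$ (with induced label $(2s+1)(12k+7)$). *)

theory Defs
  imports Main "HOL-Library.Disjoint_Sets" "HOL-Library.Extended_Nat"
begin

type_synonym 'a ugraph = "'a set \<times> 'a set set"

abbreviation verts :: "'a ugraph \<Rightarrow> 'a set" where "verts G \<equiv> fst G"
abbreviation edges :: "'a ugraph \<Rightarrow> 'a set set" where "edges G \<equiv> snd G"

definition finite_simple_graph :: "'a ugraph \<Rightarrow> bool" where
  "finite_simple_graph G \<longleftrightarrow>
     finite (verts G) \<and> (\<forall>e\<in>edges G. e \<subseteq> verts G \<and> card e = 2)"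

definition induced_label :: "'a ugraph \<Rightarrow> ('a set \<Rightarrow> nat) \<Rightarrow> 'a \<Rightarrow> nat" where
  "induced_label G f u = (\<Sum>e\<in>{e\<in>edges G. u \<in> e}. f e)"

definition local_antimagic_labeling :: "'a ugraph \<Rightarrow> ('a set \<Rightarrow> nat) \<Rightarrow> bool" where
  "local_antimagic_labeling G f \<longleftrightarrow>
     bij_betw f (edges G) {1..card (edges G)} \<and>
     (\<forall>u v. {u, v} \<in> edges G \<longrightarrow> induced_label G f u \<noteq> induced_label G f v)"

text \<open>The value is infinite exactly when no local antimagic labeling exists.\<close>

definition chi_la :: "'a ugraph \<Rightarrow> enat" where
  "chi_la G = (INF f\<in>{f. local_antimagic_labeling G f}.
                 enat (card (induced_label G f ` verts G)))"

datatype pvertex = Uv (copy: nat) | Vv (copy: nat) | Xv (copy: nat) nat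

text \<open>\<open>n\<close> disjoint copies of \<open>P\<^sub>2 \<or> O\<^sub>2\<close>.\<close>

definition copies_P2_O2 :: "nat \<Rightarrow> pvertex ugraph" where
  "copies_P2_O2 n =
    (Uv ` {1..n} \<union> Vv ` {1..n} \<union> {Xv i j |i j. i \<in> {1..n} \<and> j \<in> {1, 2}},
     {{Uv i, Vv i} |i. i \<in> {1..n}} \<union>
     {{Uv i, Xv i j} |i j. i \<in> {1..n} \<and> j \<in> {1, 2}} \<union>
     {{Vv i, Xv i j} |i j. i \<in> {1..n} \<and> j \<in> {1, 2}})"

text \<open>All endpoints of an edge of \<open>copies_P2_O2\<close> lie in the same copy, whose index is
  recovered from the edge. No natural-number subtraction below is truncated for
  \<open>1 \<le> i \<le> 2k + 1\<close>.\<close>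

definition base_label :: "nat \<Rightarrow> pvertex set \<Rightarrow> nat" where
  "base_label k e =
    (let i = the_elem (copy ` e) in
     if e = {Uv i, Vv i} then i
     else if e = {Uv i, Xv i 1} then
       (if i \<le> k + 1 then 10 * k + 7 - 2 * i else 12 * k + 8 - 2 * i)
     else if e = {Uv i, Xv i 2} then
       (if i \<le> k + 1 then 5 * k + 2 + i else 3 * k + 1 + i)
     else if e = {Vv i, Xv i 1} then
       (if i \<le> k + 1 then 3 * k + 1 + i else k + i)
     else
       (if i \<le> k + 1 then 8 * k + 6 - 2 * i else 10 * k + 7 - 2 * i))"

abbreviation base_induced_label :: "nat \<Rightarrow> pvertex \<Rightarrow> nat" where
  "base_induced_label k \<equiv> induced_label (copies_P2_O2 (2 * k + 1)) (base_label k)"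

definition S_set :: "nat \<Rightarrow> nat \<Rightarrow> nat set" where
  "S_set k j = {base_induced_label k (Xv i j) |i. i \<in> {1..2 * k + 1}}"

definition balanced_partition :: "nat \<Rightarrow> nat \<Rightarrow> nat \<Rightarrow> nat \<Rightarrow> nat set set \<Rightarrow> bool" where
  "balanced_partition k a b j P \<longleftrightarrow>
     partition_on (S_set k j) P \<and> card P = a \<and>
     (\<forall>B\<in>P. card B = b \<and> \<Sum>B = b * (12 * k + 7))"

definition block_vertices :: "nat \<Rightarrow> nat \<Rightarrow> nat set \<Rightarrow> pvertex set" where
  "block_vertices k j B =
     {Xv i j |i. i \<in> {1..2 * k + 1} \<and> base_induced_label k (Xv i j) \<in> B}"

text \<open>For a family \<open>C\<close> of pairwise disjoint vertex sets, each member of \<open>C\<close> is merged into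
  one vertex. A vertex of the merged graph is the set of old vertices merged into it, a
  singleton if the vertex lies in no member of \<open>C\<close>.\<close>

definition merge_vertex :: "'a set set \<Rightarrow> 'a \<Rightarrow> 'a set" where
  "merge_vertex C v = insert v (\<Union>{A\<in>C. v \<in> A})"

definition merge :: "'a set set \<Rightarrow> 'a ugraph \<Rightarrow> 'a set ugraph" where
  "merge C G = (merge_vertex C ` verts G, (\<lambda>e. merge_vertex C ` e) ` edges G)"

definition \<G>\<^sub>2 :: "nat \<Rightarrow> nat \<Rightarrow> nat \<Rightarrow> pvertex set ugraph set" where
  "\<G>\<^sub>2 k a b =
     {merge (block_vertices k 1 ` P1 \<union> block_vertices k 2 ` P2) (copies_P2_O2 (2 * k + 1))
       |P1 P2. balanced_partition k a b 1 P1 \<and> balanced_partition k a b 2 P2}"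


lemma base_label_simps:
  "base_label k {Uv i, Vv i} = i"
  "base_label k {Uv i, Xv i (Suc 0)} = (if i \<le> k + 1 then 10 * k + 7 - 2 * i else 12 * k + 8 - 2 * i)"
  "base_label k {Uv i, Xv i 2} = (if i \<le> k + 1 then 5 * k + 2 + i else 3 * k + 1 + i)"
  "base_label k {Vv i, Xv i (Suc 0)} = (if i \<le> k + 1 then 3 * k + 1 + i else k + i)"
  "base_label k {Vv i, Xv i 2} = (if i \<le> k + 1 then 8 * k + 6 - 2 * i else 10 * k + 7 - 2 * i)"
  by (simp_all add: base_label_def doubleton_eq_iff)

lemma base_induced_label_Uv:
  assumes "i \<in> {1..2 * k + 1}"
  shows "base_induced_label k (Uv i) = 15 * k + 9"
proof -
  have "{e \<in> edges (copies_P2_O2 (2 * k + 1)). Uv i \<in> e} =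
      {{Uv i, Vv i}, {Uv i, Xv i (Suc 0)}, {Uv i, Xv i 2}}"
    using assms by (auto simp: copies_P2_O2_def)
  then show ?thesis
    using assms by (auto simp: induced_label_def base_label_simps doubleton_eq_iff)
qed

lemma base_induced_label_Vv:
  assumes "i \<in> {1..2 * k + 1}"
  shows "base_induced_label k (Vv i) = 11 * k + 7"
proof -
  have "{e \<in> edges (copies_P2_O2 (2 * k + 1)). Vv i \<in> e} =
      {{Uv i, Vv i}, {Vv i, Xv i (Suc 0)}, {Vv i, Xv i 2}}"
    using assms by (auto simp: copies_P2_O2_def)
  then show ?thesis
    using assms by (auto simp: induced_label_def base_label_simps doubleton_eq_iff)
qed

lemma base_induced_label_Xv:
  assumes "i \<in> {1..2 * k + 1}" "j \<in> {1, 2}"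
  shows "base_induced_label k (Xv i j) = 13 * k + 8 - i"
proof -
  have "{e \<in> edges (copies_P2_O2 (2 * k + 1)). Xv i j \<in> e} =
      {{Uv i, Xv i j}, {Vv i, Xv i j}}"
    using assms by (auto simp: copies_P2_O2_def)
  then have eq: "base_induced_label k (Xv i j) =
      base_label k {Uv i, Xv i j} + base_label k {Vv i, Xv i j}"
    by (simp add: induced_label_def doubleton_eq_iff)
  consider "j = Suc 0" | "j = 2"
    using assms by auto
  then show ?thesis
    unfolding eq using assms(1) by cases (simp_all add: base_label_simps, linarith+)
qed

lemma finite_simple_graph_G2:
  assumes "G \<in> \<G>\<^sub>2 k a b"
  shows "finite_simple_graph G"
proof -
  obtain P1 P2 where G: "G = merge (block_vertices k 1 ` P1 \<union> block_vertices k 2 ` P2)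
      (copies_P2_O2 (2 * k + 1))"
    using assms by (auto simp: \<G>\<^sub>2_def)
  define C where "C = block_vertices k 1 ` P1 \<union> block_vertices k 2 ` P2"
  have U: "merge_vertex C (Uv i) = {Uv i}" and V: "merge_vertex C (Vv i) = {Vv i}" for i
    by (auto simp: merge_vertex_def C_def block_vertices_def)
  have X: "Xv i j \<in> merge_vertex C (Xv i j)" for i j
    by (simp add: merge_vertex_def)
  have ne: "{Uv i} \<noteq> merge_vertex C (Xv i j)" "{Vv i} \<noteq> merge_vertex C (Xv i j)" for i j
    using X[of i j] by auto
  have fin: "finite (verts (copies_P2_O2 (2 * k + 1)))"
  proof -
    have "{Xv i j |i j. i \<in> {1..2 * k + 1} \<and> j \<in> {1, 2}} =
        (\<lambda>(i, j). Xv i j) ` ({1..2 * k + 1} \<times> {1, 2})"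
      by auto
    then show ?thesis
      by (simp add: copies_P2_O2_def)
  qed
  have sub: "\<forall>e\<in>edges (copies_P2_O2 (2 * k + 1)). e \<subseteq> verts (copies_P2_O2 (2 * k + 1))"
    by (auto simp: copies_P2_O2_def)
  have two: "\<forall>e\<in>edges (copies_P2_O2 (2 * k + 1)). card (merge_vertex C ` e) = 2"
    using ne unfolding copies_P2_O2_def by (auto simp: U V)
  have "edges G = (\<lambda>e. merge_vertex C ` e) ` edges (copies_P2_O2 (2 * k + 1))"
    "verts G = merge_vertex C ` verts (copies_P2_O2 (2 * k + 1))"
    by (simp_all add: G merge_def C_def)
  then show ?thesis
    using fin sub two unfolding finite_simple_graph_def by (simp add: image_mono)
qed

end

theory Submission
  imports Defs
begin

text \<open>
  Three labels are necessary because each triangle \<open>u\<^sub>i v\<^sub>i x\<^sub>i\<^sub>,\<^sub>j\<close> survives the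
  merging. They suffice because merging is injective on edges, so that the base labeling carries
  over, and the induced label of a merged vertex is the sum of the old induced labels over its
  fibre: \<open>15k + 9\<close>, \<open>11k + 7\<close> and \<open>(2s + 1)(12k + 7)\<close> for the three kinds of vertices.
\<close>

section \<open>Lower bound from a triangle\<close>

lemma card_induced_label_ge_3:
  assumes f: "local_antimagic_labeling G f" and fin: "finite (verts G)"
    and tri: "{a, b} \<in> edges G" "{b, c} \<in> edges G" "{a, c} \<in> edges G"
    and abc: "{a, b, c} \<subseteq> verts G"
  shows "3 \<le> card (induced_label G f ` verts G)"
proof -
  have "card (induced_label G f ` {a, b, c}) = 3"
    using f tri unfolding local_antimagic_labeling_def by auto
  moreover have "card (induced_label G f ` {a, b, c}) \<le> card (induced_label G f ` verts G)"
    using abc fin by (intro card_mono finite_imageI image_mono)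
  ultimately show ?thesis by simp
qed

section \<open>Induced labels under merging\<close>

lemma mem_merge_vertex: "v \<in> merge_vertex C v"
  by (simp add: merge_vertex_def)

text \<open>Each merged edge inherits the label of its unique preimage. Since merging never
  identifies the two ends of an edge, an old edge whose image contains \<open>w\<close> has exactly
  one end in the fibre of \<open>w\<close>. The edges at \<open>w\<close> are thus the disjoint
  union of the old stars over that fibre.\<close>

lemma induced_label_merge:
  assumes inj: "inj_on (image (merge_vertex C)) (edges G)"
    and fin: "finite (verts G)" "finite (edges G)"
    and sub: "\<And>e. e \<in> edges G \<Longrightarrow> e \<subseteq> verts G"
    and inj_e: "\<And>e. e \<in> edges G \<Longrightarrow> inj_on (merge_vertex C) e"
  shows "induced_label (merge C G) (f \<circ> the_inv_into (edges G) (image (merge_vertex C))) w =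
    (\<Sum>v\<in>{v \<in> verts G. merge_vertex C v = w}. induced_label G f v)"
proof -
  let ?m = "image (merge_vertex C)"
  let ?E = "{e \<in> edges G. w \<in> ?m e}"
  let ?V = "{v \<in> verts G. merge_vertex C v = w}"
  have "{e \<in> edges (merge C G). w \<in> e} = ?m ` ?E"
    by (auto simp: merge_def)
  then have "induced_label (merge C G) (f \<circ> the_inv_into (edges G) ?m) w =
      (\<Sum>e\<in>?E. f (the_inv_into (edges G) ?m (?m e)))"
    unfolding induced_label_def
    by (subst sum.reindex[OF inj_on_subset[OF inj], symmetric, unfolded comp_def])
      (auto simp: sum.reindex[OF inj_on_subset[OF inj]])
  also have "\<dots> = (\<Sum>e\<in>?E. f e)"
    by (intro sum.cong) (auto simp: the_inv_into_f_f[OF inj])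
  also have "?E = (\<Union>v\<in>?V. {e \<in> edges G. v \<in> e})"
    using sub by fastforce
  also have "(\<Sum>e\<in>(\<Union>v\<in>?V. {e \<in> edges G. v \<in> e}). f e) =
      (\<Sum>v\<in>?V. \<Sum>e\<in>{e \<in> edges G. v \<in> e}. f e)"
  proof (rule sum.UNION_disjoint)
    show "\<forall>v\<in>?V. \<forall>v'\<in>?V. v \<noteq> v' \<longrightarrow> {e \<in> edges G. v \<in> e} \<inter> {e \<in> edges G. v' \<in> e} = {}"
      using inj_e unfolding inj_on_def by blast
  qed (use fin in auto)
  finally show ?thesis
    by (simp add: induced_label_def)
qed

section \<open>Bijectivity of the base labeling\<close>

text \<open>The edge kinds are listed so that, with \<open>n = 2k + 1\<close>, the base labels of kind \<open>t\<close>
  fill the interval from \<open>tn + 1\<close> to \<open>(t + 1)n\<close>.\<close>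

definition copy_edge :: "nat \<Rightarrow> nat \<Rightarrow> pvertex set" where
  "copy_edge i t =
    [{Uv i, Vv i}, {Vv i, Xv i 1}, {Uv i, Xv i 2}, {Vv i, Xv i 2}, {Uv i, Xv i 1}] ! t"

lemma copy_edge_simps:
  "copy_edge i 0 = {Uv i, Vv i}" "copy_edge i 1 = {Vv i, Xv i 1}"
  "copy_edge i 2 = {Uv i, Xv i 2}" "copy_edge i 3 = {Vv i, Xv i 2}"
  "copy_edge i 4 = {Uv i, Xv i 1}"
  by (simp_all add: copy_edge_def)

lemma lessThan_5: "{..<5} = {0, 1, 2, 3, 4 :: nat}"
  by auto

lemma edges_copies_P2_O2:
  "edges (copies_P2_O2 n) = (\<lambda>(i, t). copy_edge i t) ` ({1..n} \<times> {..<5})"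
proof -
  have "(\<lambda>(i, t). copy_edge i t) ` ({1..n} \<times> {..<5}) = (\<Union>i\<in>{1..n}. copy_edge i ` {..<5})"
    by fast
  also have "\<dots> = (\<Union>i\<in>{1..n}.
      {{Uv i, Vv i}, {Vv i, Xv i 1}, {Uv i, Xv i 2}, {Vv i, Xv i 2}, {Uv i, Xv i 1}})"
    by (simp only: lessThan_5 image_insert image_empty copy_edge_simps)
  also have "\<dots> = edges (copies_P2_O2 n)"
    unfolding copies_P2_O2_def snd_conv by blast
  finally show ?thesis ..
qed

lemma edges_copies_P2_O2_cases:
  assumes "e \<in> edges (copies_P2_O2 n)"
  obtains (UV) i where "i \<in> {1..n}" "e = {Uv i, Vv i}"
    | (UX) i j where "i \<in> {1..n}" "j \<in> {1, 2}" "e = {Uv i, Xv i j}"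
    | (VX) i j where "i \<in> {1..n}" "j \<in> {1, 2}" "e = {Vv i, Xv i j}"
  using assms unfolding copies_P2_O2_def snd_conv by blast

lemma base_label_copy_edge_bounds:
  assumes "i \<in> {1..2 * k + 1}" "t < 5"
  shows "base_label k (copy_edge i t) \<in> {t * (2 * k + 1) + 1..(t + 1) * (2 * k + 1)}"
proof -
  have "t \<in> {0, 1, 2, 3, 4}" using assms by auto
  then show ?thesis
    using assms(1) by (auto simp: copy_edge_simps[unfolded One_nat_def] base_label_simps)
qed

text \<open>The kind is read off from the interval that contains the label. Within one kind, both
  formulas, for \<open>i \<le> k + 1\<close> and for larger \<open>i\<close>, are injective, so only
  a clash between the two has to be excluded.\<close>

lemma base_label_copy_edge_inj:
  assumes i: "i \<in> {1..2 * k + 1}" "i' \<in> {1..2 * k + 1}" and t: "t < 5" "t' < 5"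
    and eq: "base_label k (copy_edge i t) = base_label k (copy_edge i' t')"
  shows "i = i' \<and> t = t'"
proof
  \<comment> \<open>Subtracting 1 shifts the interval of kind \<open>b\<close> so that it starts at
    the multiple \<open>b * (2 * k + 1)\<close>.\<close>
  have div: "(base_label k (copy_edge a b) - 1) div (2 * k + 1) = b"
    if "a \<in> {1..2 * k + 1}" "b < 5" for a b
    using base_label_copy_edge_bounds[OF that] by (intro div_nat_eqI) (auto simp: algebra_simps)
  show tt: "t = t'"
    using div[OF i(1) t(1)] div[OF i(2) t(2)] eq by simp
  \<comment> \<open>A clash between the two formulas would force
    \<open>2 * i' = 2 * i + 2 * k + 1\<close> for kinds 3 and 4, which parity forbids. For kinds 1
    and 2 it would force \<open>i' = i + 2 * k + 1\<close>, which is out of range.\<close>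
  have parity: "1 + 2 * k + 2 * m \<noteq> 2 * n" for m n
    by presburger
  consider "t = 0" | "t = 1" | "t = 2" | "t = 3" | "t = 4"
    using t(1) by linarith
  then show "i = i'"
    using eq i parity[of i i'] parity[of i' i] unfolding tt[symmetric]
    by cases (auto simp: copy_edge_simps[unfolded One_nat_def] base_label_simps split: if_splits)
qed

lemma inj_on_base_label: "inj_on (base_label k) (edges (copies_P2_O2 (2 * k + 1)))"
proof (rule inj_onI)
  fix e e'
  assume "e \<in> edges (copies_P2_O2 (2 * k + 1))" "e' \<in> edges (copies_P2_O2 (2 * k + 1))"
    and eq: "base_label k e = base_label k e'"
  then obtain i t i' t' where "i \<in> {1..2 * k + 1}" "i' \<in> {1..2 * k + 1}" "t < 5" "t' < 5"
    and "e = copy_edge i t" "e' = copy_edge i' t'"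
    unfolding edges_copies_P2_O2 by auto
  with eq show "e = e'"
    using base_label_copy_edge_inj by metis
qed

text \<open>The labels themselves tell the edges apart: equal edges have equal labels, and the label
  determines both the copy and the kind.\<close>

lemma card_edges_copies_P2_O2: "card (edges (copies_P2_O2 (2 * k + 1))) = 5 * (2 * k + 1)"
proof -
  have "inj_on (\<lambda>(i, t). copy_edge i t) ({1..2 * k + 1} \<times> {..<5})"
  proof (rule inj_onI, clarsimp)
    fix i t i' t' :: nat
    assume "Suc 0 \<le> i" "i \<le> Suc (2 * k)" "Suc 0 \<le> i'" "i' \<le> Suc (2 * k)" "t < 5" "t' < 5"
      "copy_edge i t = copy_edge i' t'"
    then show "i = i' \<and> t = t'"
      using base_label_copy_edge_inj[of i k i' t t'] by simp
  qed
  then show ?thesis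
    by (simp add: edges_copies_P2_O2 card_image)
qed

lemma bij_betw_base_label:
  "bij_betw (base_label k) (edges (copies_P2_O2 (2 * k + 1))) {1..5 * (2 * k + 1)}"
proof -
  have "base_label k ` edges (copies_P2_O2 (2 * k + 1)) \<subseteq> {1..5 * (2 * k + 1)}"
  proof (clarsimp simp: edges_copies_P2_O2 simp del: mult_Suc_right)
    fix i t :: nat
    assume "Suc 0 \<le> i" "i \<le> Suc (2 * k)" and t: "t < 5"
    then have "base_label k (copy_edge i t) \<in> {t * (2 * k + 1) + 1..(t + 1) * (2 * k + 1)}"
      by (intro base_label_copy_edge_bounds) auto
    moreover have "(t + 1) * (2 * k + 1) \<le> 5 * (2 * k + 1)"
      using t by (intro mult_right_mono) auto
    ultimately show "Suc 0 \<le> base_label k (copy_edge i t) \<and>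
        base_label k (copy_edge i t) \<le> 5 * Suc (2 * k)"
      by auto
  qed
  \<comment> \<open>Surjectivity comes from counting: the image lies in the interval and has the
    same cardinality.\<close>
  then have "base_label k ` edges (copies_P2_O2 (2 * k + 1)) = {1..5 * (2 * k + 1)}"
    by (rule card_subset_eq[OF finite_atLeastAtMost])
      (simp only: card_image[OF inj_on_base_label] card_edges_copies_P2_O2 card_atLeastAtMost
        diff_Suc_1 Suc_eq_plus1)
  then show ?thesis
    unfolding bij_betw_def using inj_on_base_label by blast
qed

section \<open>Merging along the blocks of the partitions\<close>

lemma bij_betw_comp_the_inv_into:
  assumes "inj_on g A" "bij_betw f A B"
  shows "bij_betw (f \<circ> the_inv_into A g) (g ` A) B"
  using assms by (intro bij_betw_trans[OF bij_betw_the_inv_into]) (auto simp: bij_betw_def)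

text \<open>Two blocks whose vertex sets share \<open>x\<close> both contain the base label of
  \<open>x\<close>, so they coincide by disjointness. This evaluates the union in
  \<open>merge_vertex\<close>.\<close>

lemma Union_block_vertices:
  assumes "balanced_partition k a b j P" "B \<in> P" "x \<in> block_vertices k j B"
  shows "\<Union>{A \<in> block_vertices k j ` P. x \<in> A} = block_vertices k j B"
proof -
  have "A = B" if "A \<in> P" "x \<in> block_vertices k j A" for A
    using assms that unfolding balanced_partition_def partition_on_def disjoint_def block_vertices_def
    by blast
  then show ?thesis
    using assms by blast
qed

text \<open>The label \<open>13 * k + 8 - i\<close> determines \<open>i\<close>, and every element
  of \<open>B\<close> occurs as a label because \<open>B\<close> lies in \<open>S_set k j\<close>.
  The vertex sum is therefore the block sum.\<close>

lemma sum_block_vertices: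
  assumes P: "balanced_partition k a b j P" and B: "B \<in> P" and j: "j \<in> {1, 2}"
  shows "(\<Sum>v\<in>block_vertices k j B. base_induced_label k v) = b * (12 * k + 7)"
proof -
  have "B \<subseteq> S_set k j"
    using P B unfolding balanced_partition_def partition_on_def by blast
  then have "base_induced_label k ` block_vertices k j B = B"
    unfolding S_set_def block_vertices_def by blast
  moreover have "inj_on (base_induced_label k) (block_vertices k j B)"
  proof (rule inj_onI)
    fix x y
    assume "x \<in> block_vertices k j B" "y \<in> block_vertices k j B"
      and eq: "base_induced_label k x = base_induced_label k y"
    then obtain i i' where i: "i \<in> {1..2 * k + 1}" "x = Xv i j" "i' \<in> {1..2 * k + 1}" "y = Xv i' j"
      unfolding block_vertices_def by blast
    then have "13 * k + 8 - i = 13 * k + 8 - i'"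
      using eq j base_induced_label_Xv by metis
    then show "x = y"
      using i by auto
  qed
  ultimately have "(\<Sum>v\<in>block_vertices k j B. base_induced_label k v) = \<Sum>B"
    by (metis sum.reindex_cong)
  then show ?thesis
    using P B by (simp add: balanced_partition_def)
qed

text \<open>The two partitions form one family indexed by \<open>j\<close>, so that a single
  argument covers both kinds of \<open>Xv\<close> vertices. The values follow from the fibres:
  \<open>Uv i\<close> and \<open>Vv i\<close> stay alone, and \<open>Xv i j\<close> is merged with
  exactly the vertices of its block.\<close>

lemma merged_induced_label:
  fixes k a b :: nat and P :: "nat \<Rightarrow> nat set set"
  defines "H \<equiv> copies_P2_O2 (2 * k + 1)"
    and "C \<equiv> block_vertices k 1 ` P 1 \<union> block_vertices k 2 ` P 2"
  defines "f \<equiv> base_label k \<circ> the_inv_into (edges H) (image (merge_vertex C))"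
  assumes P12: "balanced_partition k a b 1 (P 1)" "balanced_partition k a b 2 (P 2)"
  shows "bij_betw f (edges (merge C H)) {1..card (edges (merge C H))}"
    and "i \<in> {1..2 * k + 1} \<Longrightarrow> induced_label (merge C H) f (merge_vertex C (Uv i)) = 15 * k + 9"
    and "i \<in> {1..2 * k + 1} \<Longrightarrow> induced_label (merge C H) f (merge_vertex C (Vv i)) = 11 * k + 7"
    and "\<lbrakk>i \<in> {1..2 * k + 1}; j \<in> {1, 2}\<rbrakk> \<Longrightarrow>
      induced_label (merge C H) f (merge_vertex C (Xv i j)) = b * (12 * k + 7)"
proof -
  have P: "balanced_partition k a b j (P j)" if "j \<in> {1, 2}" for j
    using that P12 by auto
  have U: "merge_vertex C (Uv i) = {Uv i}" and V: "merge_vertex C (Vv i) = {Vv i}" for i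
    by (auto simp: merge_vertex_def C_def block_vertices_def)
  have X: "\<exists>B\<in>P j. merge_vertex C (Xv i j) = block_vertices k j B \<and> Xv i j \<in> block_vertices k j B"
    if ij: "i \<in> {1..2 * k + 1}" "j \<in> {1, 2}" for i j
  proof -
    have "base_induced_label k (Xv i j) \<in> \<Union>(P j)"
      using P[OF ij(2)] ij(1) unfolding balanced_partition_def partition_on_def S_set_def by blast
    then obtain B where B: "B \<in> P j" "Xv i j \<in> block_vertices k j B"
      using ij(1) by (auto simp: block_vertices_def)
    have "{A \<in> C. Xv i j \<in> A} = {A \<in> block_vertices k j ` P j. Xv i j \<in> A}"
      using ij(2) by (auto simp: C_def block_vertices_def)
    then have "merge_vertex C (Xv i j) = block_vertices k j B"
      using B Union_block_vertices[OF P[OF ij(2)] B] by (simp add: merge_vertex_def insert_absorb)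
    then show ?thesis using B by blast
  qed
  \<comment> \<open>Blocks of \<open>P 1\<close> and \<open>P 2\<close> never mix: only vertices
    with the same second index are merged.\<close>
  have XD: "j' = j" if "Xv i' j' \<in> merge_vertex C (Xv i j)" for i i' j j'
    using that by (auto simp: merge_vertex_def C_def block_vertices_def)
  have XU: "{Uv i'} \<noteq> merge_vertex C (Xv i j)" "{Vv i'} \<noteq> merge_vertex C (Xv i j)"
    "merge_vertex C (Xv i j) \<noteq> {Uv i'}" "merge_vertex C (Xv i j) \<noteq> {Vv i'}" for i i' j
    using mem_merge_vertex[of "Xv i j" C] by auto
  have XX: "merge_vertex C (Xv i j) = merge_vertex C (Xv i' j') \<Longrightarrow> j' = j" for i i' j j'
    using mem_merge_vertex XD by metis
  \<comment> \<open>Every edge has an end \<open>Uv i\<close> or \<open>Vv i\<close>, which stays a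
    singleton and so reveals the copy. If the other end is an \<open>Xv\<close> vertex, its merged
    vertex still reveals \<open>j\<close> by \<open>XX\<close>, and within a known copy this fixes
    the edge.\<close>
  have inj: "inj_on (image (merge_vertex C)) (edges H)"
  proof (rule inj_onI)
    fix e e' assume "e \<in> edges H" "e' \<in> edges H"
      and eq: "merge_vertex C ` e = merge_vertex C ` e'"
    from this(1,2) show "e = e'"
      unfolding H_def
    proof (cases rule: edges_copies_P2_O2_cases[case_product edges_copies_P2_O2_cases])
    qed (use eq in \<open>auto simp: U V doubleton_eq_iff XU dest: XX\<close>)
  qed
  have inj_e: "inj_on (merge_vertex C) e" if "e \<in> edges H" for e
    using that by (auto simp: H_def copies_P2_O2_def U V XU)
  have fin_E: "finite (edges H)"
    by (simp add: H_def edges_copies_P2_O2)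
  have sub: "e \<subseteq> verts H" if "e \<in> edges H" for e
    using that by (auto simp: H_def copies_P2_O2_def)
  have "verts H = Uv ` {1..2 * k + 1} \<union> Vv ` {1..2 * k + 1} \<union>
      (\<lambda>(i, j). Xv i j) ` ({1..2 * k + 1} \<times> {1, 2})"
    by (auto simp: H_def copies_P2_O2_def)
  then have fin_V: "finite (verts H)"
    by simp
  have lab: "induced_label (merge C H) f w =
      (\<Sum>v\<in>{v \<in> verts H. merge_vertex C v = w}. induced_label H (base_label k) v)" for w
    unfolding f_def by (rule induced_label_merge[OF inj fin_V fin_E sub inj_e])
  show "bij_betw f (edges (merge C H)) {1..card (edges (merge C H))}"
  proof -
    have "card (edges (merge C H)) = 5 * (2 * k + 1)"
      using card_image[OF inj] card_edges_copies_P2_O2[of k] by (simp add: merge_def H_def)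
    then show ?thesis
      using bij_betw_comp_the_inv_into[OF inj, of "base_label k"] bij_betw_base_label[of k]
      by (simp add: merge_def H_def f_def)
  qed
  show "induced_label (merge C H) f (merge_vertex C (Uv i)) = 15 * k + 9"
    if i: "i \<in> {1..2 * k + 1}"
  proof -
    have "{v \<in> verts H. merge_vertex C v = {Uv i}} = {Uv i}"
    proof (intro equalityI subsetI)
      fix v assume "v \<in> {v \<in> verts H. merge_vertex C v = {Uv i}}"
      then show "v \<in> {Uv i}"
        by (metis (mono_tags) mem_Collect_eq mem_merge_vertex)
    next
      fix v assume "v \<in> {Uv i}"
      then show "v \<in> {v \<in> verts H. merge_vertex C v = {Uv i}}"
        using i by (simp add: H_def copies_P2_O2_def U)
    qed
    then show ?thesis
      using base_induced_label_Uv[OF i, folded H_def] by (simp add: lab U)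
  qed
  show "induced_label (merge C H) f (merge_vertex C (Vv i)) = 11 * k + 7"
    if i: "i \<in> {1..2 * k + 1}"
  proof -
    have "{v \<in> verts H. merge_vertex C v = {Vv i}} = {Vv i}"
    proof (intro equalityI subsetI)
      fix v assume "v \<in> {v \<in> verts H. merge_vertex C v = {Vv i}}"
      then show "v \<in> {Vv i}"
        by (metis (mono_tags) mem_Collect_eq mem_merge_vertex)
    next
      fix v assume "v \<in> {Vv i}"
      then show "v \<in> {v \<in> verts H. merge_vertex C v = {Vv i}}"
        using i by (simp add: H_def copies_P2_O2_def V)
    qed
    then show ?thesis
      using base_induced_label_Vv[OF i, folded H_def] by (simp add: lab V)
  qed
  show "induced_label (merge C H) f (merge_vertex C (Xv i j)) = b * (12 * k + 7)"
    if ij: "i \<in> {1..2 * k + 1}" "j \<in> {1, 2}"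
  proof -
    obtain B where B: "B \<in> P j" "merge_vertex C (Xv i j) = block_vertices k j B"
      using X[OF ij] by blast
    have "{v \<in> verts H. merge_vertex C v = block_vertices k j B} = block_vertices k j B"
    proof (intro equalityI subsetI)
      fix v assume "v \<in> {v \<in> verts H. merge_vertex C v = block_vertices k j B}"
      then show "v \<in> block_vertices k j B"
        by (metis (mono_tags) mem_Collect_eq mem_merge_vertex)
    next
      fix v assume v: "v \<in> block_vertices k j B"
      then obtain i' where i': "v = Xv i' j" "i' \<in> {1..2 * k + 1}"
        by (auto simp: block_vertices_def)
      obtain B' where B': "B' \<in> P j" "merge_vertex C v = block_vertices k j B'"
        "v \<in> block_vertices k j B'"
        using X[OF i'(2) ij(2)] i'(1) by blast
      \<comment> \<open>Both sets are the union of all block vertex sets containing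
        \<open>v\<close>.\<close>
      have "block_vertices k j B' = block_vertices k j B"
        using Union_block_vertices[OF P[OF ij(2)] B'(1,3)]
          Union_block_vertices[OF P[OF ij(2)] B(1) v] by (rule trans[OF sym])
      then show "v \<in> {v \<in> verts H. merge_vertex C v = block_vertices k j B}"
        using i' ij(2) B'(2) by (auto simp: H_def copies_P2_O2_def)
    qed
    then show ?thesis
      using sum_block_vertices[OF P[OF ij(2)] B(1) ij(2), folded H_def] by (simp only: lab B(2))
  qed
qed

section \<open>The local antimagic chromatic number of the merged graphs\<close>

theorem theorem2p2:
  fixes k r s :: nat and G :: "pvertex set ugraph"
  assumes "r \<ge> 1" and "s \<ge> 1"
    and "2 * k + 1 = (2 * r + 1) * (2 * s + 1)"
    and "G \<in> \<G>\<^sub>2 k (2 * r + 1) (2 * s + 1)"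
  shows "chi_la G = 3"
proof -
  obtain P1 P2 where P12: "balanced_partition k (2 * r + 1) (2 * s + 1) 1 P1"
      "balanced_partition k (2 * r + 1) (2 * s + 1) 2 P2"
    and G12: "G = merge (block_vertices k 1 ` P1 \<union> block_vertices k 2 ` P2)
      (copies_P2_O2 (2 * k + 1))"
    using assms(4) by (auto simp: \<G>\<^sub>2_def)
  define P where "P j = (if j = 1 then P1 else P2)" for j :: nat
  define H where "H = copies_P2_O2 (2 * k + 1)"
  define C where "C = block_vertices k 1 ` P 1 \<union> block_vertices k 2 ` P 2"
  define f where "f = base_label k \<circ> the_inv_into (edges H) (image (merge_vertex C))"
  define c where "c = (2 * s + 1) * (12 * k + 7)"
  have P: "balanced_partition k (2 * r + 1) (2 * s + 1) 1 (P 1)"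
    "balanced_partition k (2 * r + 1) (2 * s + 1) 2 (P 2)"
    using P12 by (simp_all add: P_def)
  have G: "G = merge C H"
    by (simp add: G12 C_def H_def P_def)
  note lab = merged_induced_label[OF P, folded H_def, folded C_def, folded f_def, folded G c_def]
  \<comment> \<open>As \<open>s \<ge> 1\<close>, the block size is at least 3, which lifts
    \<open>c\<close> above \<open>15 * k + 9\<close> and hence also above \<open>11 * k + 7\<close>.
    So the three values are pairwise distinct.\<close>
  have "3 * (12 * k + 7) \<le> c"
    unfolding c_def using assms(2) by (intro mult_right_mono) auto
  then have c: "15 * k + 9 < c"
    by simp
  have verts_G: "verts G = merge_vertex C ` verts H"
    and edges_G: "edges G = image (merge_vertex C) ` edges H"
    by (simp_all add: G merge_def)
  have neq: "induced_label G f (merge_vertex C x) \<noteq> induced_label G f (merge_vertex C y)"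
    if "{x, y} \<in> edges H" for x y
    using that unfolding H_def
    by (cases rule: edges_copies_P2_O2_cases) (use c in \<open>auto simp: lab doubleton_eq_iff\<close>)
  have "induced_label G f u \<noteq> induced_label G f v" if uv: "{u, v} \<in> edges G" for u v
  proof -
    obtain e where e: "e \<in> edges H" "{u, v} = merge_vertex C ` e"
      using uv by (auto simp: edges_G)
    then obtain x y where "e = {x, y}"
      by (auto simp: H_def copies_P2_O2_def)
    with e neq[of x y] show ?thesis
      by (auto simp: doubleton_eq_iff)
  qed
  then have f: "local_antimagic_labeling G f"
    using lab(1) by (simp add: local_antimagic_labeling_def)
  have "induced_label G f ` verts G \<subseteq> {15 * k + 9, 11 * k + 7, c}"
    unfolding verts_G by (auto simp: H_def copies_P2_O2_def lab)
  then have "card (induced_label G f ` verts G) \<le> card {15 * k + 9, 11 * k + 7, c}"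
    by (intro card_mono) auto
  also have "\<dots> \<le> 3"
    by (simp add: card_insert_if)
  finally have "enat (card (induced_label G f ` verts G)) \<le> 3"
    by (simp add: numeral_eq_enat)
  then have upper: "chi_la G \<le> 3"
    unfolding chi_la_def using f by (intro INF_lower2[of f]) auto
  \<comment> \<open>The triangle of the first copy with \<open>j = 1\<close>; its image yields the
    lower bound for every labeling.\<close>
  have tri: "{merge_vertex C (Uv 1), merge_vertex C (Vv 1)} \<in> edges G"
    "{merge_vertex C (Vv 1), merge_vertex C (Xv 1 1)} \<in> edges G"
    "{merge_vertex C (Uv 1), merge_vertex C (Xv 1 1)} \<in> edges G"
  proof -
    have "{Uv 1, Vv 1} \<in> edges H" "{Vv 1, Xv 1 1} \<in> edges H" "{Uv 1, Xv 1 1} \<in> edges H"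
      by (auto simp: H_def copies_P2_O2_def)
    from this[THEN imageI[of _ _ "image (merge_vertex C)"]]
    show "{merge_vertex C (Uv 1), merge_vertex C (Vv 1)} \<in> edges G"
      "{merge_vertex C (Vv 1), merge_vertex C (Xv 1 1)} \<in> edges G"
      "{merge_vertex C (Uv 1), merge_vertex C (Xv 1 1)} \<in> edges G"
      by (simp_all add: edges_G)
  qed
  have simple: "finite (verts G)" "\<And>e. e \<in> edges G \<Longrightarrow> e \<subseteq> verts G"
    using finite_simple_graph_G2[OF assms(4)] by (auto simp: finite_simple_graph_def)
  have "3 \<le> chi_la G"
    unfolding chi_la_def
  proof (rule INF_greatest)
    fix g assume "g \<in> {g. local_antimagic_labeling G g}"
    then have "3 \<le> card (induced_label G g ` verts G)"
      using tri simple(2)[OF tri(1)] simple(2)[OF tri(2)]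
      by (intro card_induced_label_ge_3[OF _ simple(1) tri]) auto
    then show "3 \<le> enat (card (induced_label G g ` verts G))"
      by (simp add: numeral_eq_enat)
  qed
  with upper show ?thesis
    by (rule antisym)
qed

end
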